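(* Let $L=\|K\|$, let $\beta>0$ and $\tau,\sigma>0$ satisfy $\tau L_f+\sigma\tau L^2+\tau\beta L<1$, let $i\in\{1,2,3\}$, and let $(x^n,y^n)_{n\ge 0}$ be generated from $(x^0,y^0)\in\mathcal X\times\mathcal Y$, with $x^{-1}=x^0$, by $$y^{n+1}\approx_2^{\delta_{n+1}}\mathrm{prox}_{\sigma h^*}\big(y^n+\sigma K(2x^n-x^{n-1})\big),\qquad x^{n+1}\approx_i^{\varepsilon_{n+1}}\mathrm{prox}_{\tau g}\big(x^n-\tau(K^*y^{n+1}+\nabla f(x^n)+e^{n+1})\big),$$ for all $n\ge 0$, where $\varepsilon_n,\delta_n\ge 0$ and $e^n\in\mathcal X$ $(n\ge1)$ are given errors. For $N\ge1$ put $X^N:=\frac1N\sum_{n=1}^N x^n$ and $Y^N:=\frac1N\sum_{n=1}^N y^n$. Then for every $N\ge 1$ and every saddle point $(x^\star,y^\star)\in\mathcal X\times\mathcal Y$ of $\mathcal L$, $$\mathcal L(X^N,y^\star)-\mathcal L(x^\star,Y^N)\le\frac1{2\tau N}\Big(\|x^\star-x^0\|+\sqrt{\tfrac{\tau}{\sigma}}\,\|y^\star-y^0\|+2A_{N,i}+\sqrt{2B_{N,i}}\Big)^2,$$ where $$A_{N,1}=A_{N,3}=\sum_{n=1}^N\big(\tau\|e^n\|+\sqrt{2\tau\varepsilon_n}\big),\qquad A_{N,2}=\sum_{n=1}^N\tau\|e^n\|,$$ $$B_{N,1}=B_{N,2}=\sum_{n=1}^N(\tau\varepsilon_n+\tau\delta_n),\qquad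 B_{N,3}=\sum_{n=1}^N\tau\delta_n.$$
   Context: $\mathcal X,\mathcal Y$ are real Hilbert spaces and $\bar{\mathbb R}=\mathbb R\cup\{+\infty\}$. $K:\mathcal X\to\mathcal Y$ is a bounded linear operator; $f:\mathcal X\to\bar{\mathbb R}$ is proper, convex, lower semicontinuous and differentiable with $\|\nabla f(x)-\nabla f(x')\|\le L_f\|x-x'\|$ for all $x,x'\in\mathrm{dom} f$; $g:\mathcal X\to\bar{\mathbb R}$ and $h:\mathcal Y\to\bar{\mathbb R}$ are proper, convex, lower semicontinuous; $h^*$ is the convex conjugate of $h$. Put $$\mathcal L(x,y)=\langle Kx,y\rangle+f(x)+g(x)-h^*(y).$$ A saddle point is a pair $(x^\star,y^\star)$ with $\mathcal L(x^\star,y)\le\mathcal L(x^\star,y^\star)\le\mathcal L(x,y^\star)$ for all $(x,y)\in\mathcal X\times\mathcal Y$; at least one is assumed to exist. Inexact proximal points. For a proper, convex, lower semicontinuous $\varphi:\mathcal H\to\bar{\mathbb R}$ on a Hilbert space $\mathcal H$, $\lambda>0$ and $v\in\mathcal H$, let $\mathrm{prox}_{\lambda\varphi}(v)=\arg\min_{u}\{\frac1{2\lambda}\|u-v\|^2+\varphi(u)\}$ and $\Phi_\lambda(u)=\frac1{2\lambda}\|u-v\|^2+\varphi(u)$. For $\varepsilon\ge0$, $\partial_\varepsilon\varphi(z)=\{p:\varphi(u)\ge\varphi(z)+\langle p,u-z\rangle-\varepsilon\ \forall u\}$. Then - $z\approx_1^{\varepsilon}\mathrm{prox}_{\lambda\varphi}(v)$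 means $0\in\partial_\varepsilon\Phi_\lambda(z)$; - $z\approx_2^{\varepsilon}\mathrm{prox}_{\lambda\varphi}(v)$ means $(v-z)/\lambda\in\partial_\varepsilon\varphi(z)$; - $z\approx_3^{\varepsilon}\mathrm{prox}_{\lambda\varphi}(v)$ means there is $r\in\mathcal H$ with $\|r\|\le\sqrt{2\lambda\varepsilon}$ and $z=\mathrm{prox}_{\lambda\varphi}(v+r)$. *)

theory Defs
  imports "HOL-Analysis.Analysis"
begin

text \<open>Functions into \<open>\<real> \<union> {\<infinity>}\<close> are rendered with values in \<^typ>\<open>ereal\<close>; \<open>proper\<close> below
  rules out the value \<open>-\<infinity>\<close>.\<close>

definition edom :: "('a \<Rightarrow> ereal) \<Rightarrow> 'a set" where
  "edom f = {x. f x < \<infinity>}"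

definition proper :: "('a \<Rightarrow> ereal) \<Rightarrow> bool" where
  "proper f \<longleftrightarrow> (\<forall>x. f x \<noteq> -\<infinity>) \<and> (\<exists>x. f x \<noteq> \<infinity>)"

definition convex_ereal :: "('a::real_vector \<Rightarrow> ereal) \<Rightarrow> bool" where
  "convex_ereal f \<longleftrightarrow> (\<forall>x y. \<forall>u\<ge>0. \<forall>v\<ge>0. u + v = 1 \<longrightarrow>
      f (u *\<^sub>R x + v *\<^sub>R y) \<le> ereal u * f x + ereal v * f y)"

definition lsc :: "('a::topological_space \<Rightarrow> ereal) \<Rightarrow> bool" where
  "lsc f \<longleftrightarrow> (\<forall>x. f x \<le> Liminf (at x) f)"

definition proper_convex_lsc :: "('a::real_normed_vector \<Rightarrow> ereal) \<Rightarrow> bool" where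
  "proper_convex_lsc f \<longleftrightarrow> proper f \<and> convex_ereal f \<and> lsc f"

definition conjugate :: "('a::real_inner \<Rightarrow> ereal) \<Rightarrow> 'a \<Rightarrow> ereal" where
  "conjugate h y = (SUP x. ereal (x \<bullet> y) - h x)"

text \<open>Frechet gradient at a point near which the function is finite. The interior condition is
  needed because \<^const>\<open>real_of_ereal\<close> sends \<open>\<infinity>\<close> to \<open>0\<close>.\<close>

definition has_gradient :: "('a::real_inner \<Rightarrow> ereal) \<Rightarrow> 'a \<Rightarrow> 'a \<Rightarrow> bool" where
  "has_gradient f x p \<longleftrightarrow>
     x \<in> interior (edom f) \<and> (GDERIV (\<lambda>u. real_of_ereal (f u)) x :> p)"

definition eps_subdifferential :: "real \<Rightarrow> ('a::real_inner \<Rightarrow> ereal) \<Rightarrow> 'a \<Rightarrow> 'a set" where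
  "eps_subdifferential eps phi z =
     {p. \<forall>u. phi u \<ge> phi z + ereal (p \<bullet> (u - z)) - ereal eps}"

definition prox_objective :: "real \<Rightarrow> ('a::real_inner \<Rightarrow> ereal) \<Rightarrow> 'a \<Rightarrow> 'a \<Rightarrow> ereal" where
  "prox_objective lam phi v u = ereal (1 / (2 * lam) * (norm (u - v))\<^sup>2) + phi u"

text \<open>The set of minimizers. It is a singleton when \<open>phi\<close> is proper, convex and lower
  semicontinuous on a Hilbert space and \<open>lam > 0\<close>, so that \<open>z = prox(v)\<close> is
  \<open>z \<in> prox lam phi v\<close>.\<close>

definition prox :: "real \<Rightarrow> ('a::real_inner \<Rightarrow> ereal) \<Rightarrow> 'a \<Rightarrow> 'a set" where
  "prox lam phi v = {z. is_arg_min (prox_objective lam phi v) (\<lambda>_. True) z}"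

definition inexact_prox1 ::
    "real \<Rightarrow> real \<Rightarrow> ('a::real_inner \<Rightarrow> ereal) \<Rightarrow> 'a \<Rightarrow> 'a \<Rightarrow> bool" where
  "inexact_prox1 eps lam phi v z \<longleftrightarrow> 0 \<in> eps_subdifferential eps (prox_objective lam phi v) z"

definition inexact_prox2 ::
    "real \<Rightarrow> real \<Rightarrow> ('a::real_inner \<Rightarrow> ereal) \<Rightarrow> 'a \<Rightarrow> 'a \<Rightarrow> bool" where
  "inexact_prox2 eps lam phi v z \<longleftrightarrow> (1 / lam) *\<^sub>R (v - z) \<in> eps_subdifferential eps phi z"

definition inexact_prox3 ::
    "real \<Rightarrow> real \<Rightarrow> ('a::real_inner \<Rightarrow> ereal) \<Rightarrow> 'a \<Rightarrow> 'a \<Rightarrow> bool" where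
  "inexact_prox3 eps lam phi v z \<longleftrightarrow>
     (\<exists>r. norm r \<le> sqrt (2 * lam * eps) \<and> z \<in> prox lam phi (v + r))"

text \<open>Only the types \<open>i \<in> {1, 2, 3}\<close> are meaningful.\<close>

definition inexact_prox ::
    "nat \<Rightarrow> real \<Rightarrow> real \<Rightarrow> ('a::real_inner \<Rightarrow> ereal) \<Rightarrow> 'a \<Rightarrow> 'a \<Rightarrow> bool" where
  "inexact_prox i eps lam phi v z \<longleftrightarrow>
     (if i = 1 then inexact_prox1 eps lam phi v z
      else if i = 2 then inexact_prox2 eps lam phi v z
      else inexact_prox3 eps lam phi v z)"

text \<open>Where \<open>f x + g x\<close> and \<open>conjugate h y\<close> are both \<open>\<infinity>\<close>, the library convention
  \<open>\<infinity> - \<infinity> = \<infinity>\<close> applies. It does not affect which pairs are saddle points when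
  \<open>edom f \<inter> edom g\<close> and \<open>edom (conjugate h)\<close> are nonempty: the components of every saddle
  point then lie in these two sets.\<close>

definition Lagrangian ::
    "('a::real_inner \<Rightarrow> 'b::real_inner) \<Rightarrow> ('a \<Rightarrow> ereal) \<Rightarrow> ('a \<Rightarrow> ereal) \<Rightarrow> ('b \<Rightarrow> ereal)
      \<Rightarrow> 'a \<Rightarrow> 'b \<Rightarrow> ereal" where
  "Lagrangian K f g h x y = ereal (K x \<bullet> y) + f x + g x - conjugate h y"

definition saddle_point :: "('a \<Rightarrow> 'b \<Rightarrow> ereal) \<Rightarrow> 'a \<Rightarrow> 'b \<Rightarrow> bool" where
  "saddle_point L xs ys \<longleftrightarrow> (\<forall>x y. L xs y \<le> L xs ys \<and> L xs ys \<le> L x ys)"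

definition err_A :: "nat \<Rightarrow> real \<Rightarrow> (nat \<Rightarrow> 'a::real_normed_vector) \<Rightarrow> (nat \<Rightarrow> real) \<Rightarrow> nat \<Rightarrow> real"
  where
  "err_A i tau e eps N =
     (if i = 2 then (\<Sum>n=1..N. tau * norm (e n))
      else (\<Sum>n=1..N. tau * norm (e n) + sqrt (2 * tau * eps n)))"

definition err_B :: "nat \<Rightarrow> real \<Rightarrow> (nat \<Rightarrow> real) \<Rightarrow> (nat \<Rightarrow> real) \<Rightarrow> nat \<Rightarrow> real" where
  "err_B i tau eps del N =
     (if i = 3 then (\<Sum>n=1..N. tau * del n)
      else (\<Sum>n=1..N. tau * eps n + tau * del n))"

text \<open>The extrapolated point \<open>2 x\<^sup>n - x\<^sup>n\<^sup>-\<^sup>1\<close>. Truncated subtraction on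
  \<^typ>\<open>nat\<close> gives \<open>x (0 - 1) = x 0\<close>, i.e. \<open>x\<^sup>-\<^sup>1 = x\<^sup>0\<close>.\<close>

definition extrapolate :: "(nat \<Rightarrow> 'a::real_vector) \<Rightarrow> nat \<Rightarrow> 'a" where
  "extrapolate x n = 2 *\<^sub>R x n - x (n - 1)"

definition ergodic_mean :: "(nat \<Rightarrow> 'a::real_vector) \<Rightarrow> nat \<Rightarrow> 'a" where
  "ergodic_mean x N = (1 / real N) *\<^sub>R (\<Sum>n=1..N. x n)"

end

theory Submission
  imports Defs
begin

text \<open>Each proximal step gives an inequality of the form
  \<open>g z - g u \<le> \<langle>v - z, z - u\<rangle> / \<tau> + b + a \<parallel>z - u\<parallel> / \<tau>\<close>. For type 1 this follows from testing
  the \<open>\<epsilon>\<close>-minimality of \<open>z\<close> on the segment from \<open>z\<close> to \<open>u\<close>. Adding the dual inequality and the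
  descent inequality for \<open>f\<close>, the coupling terms telescope because of the extrapolation, so that
  \<open>2 \<tau>\<close> times the sum of the duality gaps plus \<open>\<parallel>x\<^sup>n - xstar\<parallel>\<^sup>2\<close> is bounded by the initial distances, the
  errors and a sum linear in \<open>\<parallel>x\<^sup>k - xstar\<parallel>\<close> with \<open>k \<le> n\<close>. The gaps are nonnegative, which bounds these
  distances. Jensen's inequality passes to the ergodic means.

  Completeness enters through the projection theorem: it yields the adjoint of \<open>K\<close>
  (the library has its existence only in finite dimension) and, by projecting onto the
  epigraph, an affine minorant of \<open>h\<close>, without which \<open>conjugate h\<close> could be identically \<open>\<infinity>\<close>.\<close>

section \<open>Projection, adjoints and conjugates in Hilbert spaces\<close>

text \<open>A minimizing sequence is Cauchy by the parallelogram law, because midpoints stay in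
  \<open>C\<close> and hence cannot be closer to \<open>z\<close> than the infimum. Completeness
  then supplies the minimizer.\<close>

lemma closest_point_hilbert:
  fixes C :: "'a::{real_inner, complete_space} set"
  assumes "convex C" "closed C" "C \<noteq> {}"
  obtains p where "p \<in> C" "\<And>u. u \<in> C \<Longrightarrow> (z - p) \<bullet> (u - p) \<le> 0"
proof -
  define I where "I = (INF u\<in>C. (norm (u - z))\<^sup>2)"
  have bdd: "bdd_below ((\<lambda>u. (norm (u - z))\<^sup>2) ` C)"
    by (rule bdd_belowI[of _ 0]) auto
  have I_le: "I \<le> (norm (u - z))\<^sup>2" if "u \<in> C" for u
    unfolding I_def using bdd that by (rule cINF_lower)
  have "\<exists>u\<in>C. (norm (u - z))\<^sup>2 < I + 1 / real (Suc n)" for n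
  proof (rule ccontr)
    assume "\<not> ?thesis"
    then have "I + 1 / real (Suc n) \<le> I"
      unfolding I_def using assms(3) by (intro cINF_greatest) auto
    then show False
      by (simp add: field_simps)
  qed
  then obtain c where c: "\<And>n. c n \<in> C" "\<And>n. (norm (c n - z))\<^sup>2 < I + 1 / real (Suc n)"
    by metis
  have cauchy_bound: "(norm (c m - c n))\<^sup>2 \<le> 2 / real (Suc m) + 2 / real (Suc n)" for m n
  proof -
    have "(1/2) *\<^sub>R c m + (1/2) *\<^sub>R c n \<in> C"
      using assms(1) c(1) by (intro convexD) auto
    then have "I \<le> (norm ((1/2) *\<^sub>R c m + (1/2) *\<^sub>R c n - z))\<^sup>2"
      by (rule I_le)
    \<comment> \<open>The parallelogram law for \<open>c m - z\<close> and
      \<open>c n - z\<close>.\<close>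
    moreover have "(norm (c m - c n))\<^sup>2 = 2 * (norm (c m - z))\<^sup>2 + 2 * (norm (c n - z))\<^sup>2
        - 4 * (norm ((1/2) *\<^sub>R c m + (1/2) *\<^sub>R c n - z))\<^sup>2"
      by (simp add: power2_norm_eq_inner inner_simps inner_commute algebra_simps)
    ultimately show ?thesis
      using c(2)[of m] c(2)[of n] by simp
  qed
  have "Cauchy c"
  proof (rule metric_CauchyI)
    fix r :: real assume "0 < r"
    obtain M where M: "inverse (real (Suc M)) < r\<^sup>2 / 4"
      using reals_Archimedean[of "r\<^sup>2 / 4"] \<open>0 < r\<close> by auto
    have "dist (c m) (c n) < r" if "M \<le> m" "M \<le> n" for m n
    proof -
      have "1 / real (Suc m) \<le> inverse (real (Suc M))" "1 / real (Suc n) \<le> inverse (real (Suc M))"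
        using that by (auto simp: divide_simps)
      with cauchy_bound[of m n] M have "(norm (c m - c n))\<^sup>2 < r\<^sup>2"
        by simp
      then show ?thesis
        using \<open>0 < r\<close> by (metis dist_norm less_imp_le power2_less_imp_less)
    qed
    then show "\<exists>M. \<forall>m\<ge>M. \<forall>n\<ge>M. dist (c m) (c n) < r" by blast
  qed
  then obtain p where p: "c \<longlonglongrightarrow> p"
    using Cauchy_convergent convergent_def by blast
  have "p \<in> C"
    using assms(2) c(1) p by (rule closed_sequentially)
  have "(\<lambda>n. I + 1 / real (Suc n)) \<longlonglongrightarrow> I + 0"
    by (intro tendsto_intros LIMSEQ_Suc lim_1_over_n)
  moreover have "(\<lambda>n. (norm (c n - z))\<^sup>2) \<longlonglongrightarrow> (norm (p - z))\<^sup>2"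
    by (intro tendsto_intros p)
  ultimately have "(norm (p - z))\<^sup>2 \<le> I + 0"
    by (intro LIMSEQ_le[where Y = "\<lambda>n. I + 1 / real (Suc n)"]) (use c(2) in \<open>auto intro: less_imp_le\<close>)
  then have "dist z p \<le> dist z u" if "u \<in> C" for u
    using I_le[OF that] by (metis add_0_right dist_commute dist_norm norm_ge_zero order_trans power2_le_imp_le)
  then show ?thesis
    using that \<open>p \<in> C\<close> any_closest_point_dot[OF assms(1,2)] by blast
qed

text \<open>The point of the hyperplane \<open>\<phi> = 1\<close> closest to the origin is
  orthogonal to the kernel of \<phi>, so a rescaling of it represents \<phi>.\<close>

lemma riesz_representation:
  fixes \<phi> :: "'a::{real_inner, complete_space} \<Rightarrow> real"
  assumes "bounded_linear \<phi>"
  obtains w where "\<And>u. \<phi> u = u \<bullet> w"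
proof (cases "\<forall>u. \<phi> u = 0")
  case True
  then show ?thesis using that[of 0] by simp
next
  case False
  interpret bounded_linear \<phi> by fact
  from False obtain u0 where "\<phi> u0 \<noteq> 0" by auto
  define C where "C = {u. \<phi> u = 1}"
  have "convex C"
    unfolding C_def convex_def by (simp add: add scaleR)
  moreover have "closed C"
    unfolding C_def by (intro closed_Collect_eq continuous_intros continuous_on)
  moreover have "(1 / \<phi> u0) *\<^sub>R u0 \<in> C"
    unfolding C_def using \<open>\<phi> u0 \<noteq> 0\<close> by (simp add: scaleR)
  ultimately obtain p where "p \<in> C" and p: "\<And>u. u \<in> C \<Longrightarrow> (0 - p) \<bullet> (u - p) \<le> 0"
    using closest_point_hilbert[of C 0] by blast
  have "\<phi> p = 1" using \<open>p \<in> C\<close> by (simp add: C_def)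
  \<comment> \<open>Both \<open>p + w\<close> and \<open>p - w\<close> lie on the hyperplane, so the
    variational inequality holds with both signs.\<close>
  have orth: "p \<bullet> w = 0" if "\<phi> w = 0" for w
    using p[of "p + w"] p[of "p - w"] that \<open>\<phi> p = 1\<close> by (simp add: C_def add diff)
  have "p \<bullet> p \<noteq> 0" using \<open>\<phi> p = 1\<close> zero by auto
  have "\<phi> u = u \<bullet> ((1 / (p \<bullet> p)) *\<^sub>R p)" for u
    using orth[of "u - \<phi> u *\<^sub>R p"] \<open>\<phi> p = 1\<close> \<open>p \<bullet> p \<noteq> 0\<close>
    by (simp add: diff scaleR inner_diff_right inner_commute field_simps)
  then show ?thesis by (rule that)
qed

text \<open>\<open>adjoint\<close> is defined by choice, so its defining identity holds once some
  adjoint exists; Riesz representation provides its value at each \<open>v\<close>.\<close>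

lemma adjoint_hilbert:
  fixes K :: "'a::{real_inner, complete_space} \<Rightarrow> 'b::real_inner"
  assumes "bounded_linear K"
  shows "K u \<bullet> v = u \<bullet> adjoint K v"
proof -
  have "\<exists>w. \<forall>u. K u \<bullet> v = u \<bullet> w" for v
  proof -
    have "bounded_linear (\<lambda>u. K u \<bullet> v)"
      using bounded_linear_inner_left assms by (rule bounded_linear_compose)
    then show ?thesis by (metis riesz_representation)
  qed
  then obtain K' where K': "\<forall>u v. K u \<bullet> v = u \<bullet> K' v" by metis
  then show ?thesis by (simp add: adjoint_unique[OF K'])
qed

section \<open>Lower semicontinuity, epigraphs and conjugates\<close>

lemma lsc_eventually:
  assumes "lsc f" "c < f a"
  shows "\<forall>\<^sub>F u in nhds a. c < f u"
proof -
  have "f a \<le> Liminf (at a) f" using assms(1) by (simp add: lsc_def)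
  then have "\<forall>\<^sub>F u in at a. c < f u" using assms(2) by (simp add: le_Liminf_iff)
  then show ?thesis
    using assms(2) by (auto simp: eventually_at_filter elim!: eventually_mono)
qed

lemma open_superlevel_lsc:
  assumes "lsc f"
  shows "open {u. c < f u}"
  unfolding open_subopen[of "{u. c < f u}"]
  using lsc_eventually[OF assms] by (fastforce simp: eventually_nhds)

lemma closed_epigraph:
  assumes "lsc (h :: 'a::topological_space \<Rightarrow> ereal)"
  shows "closed {(u, t). h u \<le> ereal t}"
proof -
  have "\<exists>T. open T \<and> w \<in> T \<and> T \<subseteq> - {(u, t). h u \<le> ereal t}" if "w \<in> - {(u, t). h u \<le> ereal t}" for w
  proof -
    obtain u t where w: "w = (u, t)" by force
    with that obtain s where s: "ereal t < ereal s" "ereal s < h u"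
      using ereal_dense2[of "ereal t" "h u"] by (auto simp: not_le)
    \<comment> \<open>With \<open>s\<close> strictly between \<open>t\<close> and
      \<open>h u\<close>, this open box separates \<open>(u, t)\<close> from the epigraph.\<close>
    have "{u. ereal s < h u} \<times> {..<s} \<subseteq> - {(u, t). h u \<le> ereal t}"
      by (auto dest: less_le_trans simp: not_le)
    then show ?thesis
      using s w open_superlevel_lsc[OF assms] by (intro exI[of _ "{u. ereal s < h u} \<times> {..<s}"]) (auto intro: open_Times)
  qed
  then show ?thesis
    unfolding closed_def by (subst open_subopen) blast
qed

lemma convex_epigraph:
  fixes h :: "'a::real_vector \<Rightarrow> ereal"
  assumes "convex_ereal h"
  shows "convex {(u, t). h u \<le> ereal t}"
proof (rule convexI, clarsimp)
  fix u v :: real and a b :: 'a and s t :: real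
  assume *: "h a \<le> ereal s" "h b \<le> ereal t" "0 \<le> u" "0 \<le> v" "u + v = 1"
  have "h (u *\<^sub>R a + v *\<^sub>R b) \<le> ereal u * h a + ereal v * h b"
    using assms * by (simp add: convex_ereal_def)
  also have "\<dots> \<le> ereal u * ereal s + ereal v * ereal t"
    using * by (intro add_mono ereal_mult_left_mono) auto
  finally show "h (u *\<^sub>R a + v *\<^sub>R b) \<le> ereal (u * s + v * t)"
    by simp
qed

text \<open>Projecting a point strictly below the graph onto the epigraph yields a separating
  hyperplane. It is not vertical because the chosen point lies below a point where \<open>h\<close>
  is finite, so it can be solved for the second coordinate.\<close>

lemma affine_minorant:
  fixes h :: "'a::{real_inner, complete_space} \<Rightarrow> ereal"
  assumes "proper_convex_lsc h"
  obtains p c where "\<And>u. ereal (u \<bullet> p - c) \<le> h u"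
proof -
  have h: "\<And>u. h u \<noteq> -\<infinity>" "convex_ereal h" "lsc h"
    using assms by (auto simp: proper_convex_lsc_def proper_def)
  obtain a r where a: "h a = ereal r"
    using assms by (metis proper_convex_lsc_def proper_def ereal_cases)
  define C where "C = {(u, t). h u \<le> ereal t}"
  have "(a, r) \<in> C" using a by (simp add: C_def)
  then obtain w where "w \<in> C" and w: "\<And>v. v \<in> C \<Longrightarrow> ((a, r - 1) - w) \<bullet> (v - w) \<le> 0"
    using closest_point_hilbert[of C "(a, r - 1)"] closed_epigraph[OF h(3)] convex_epigraph[OF h(2)]
    unfolding C_def by (metis (no_types, lifting) empty_iff)
  obtain b s where ws: "w = (b, s)" by force
  have bs: "h b \<le> ereal s" using \<open>w \<in> C\<close> ws by (simp add: C_def)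
  have sep: "(a - b) \<bullet> (u - b) + (r - 1 - s) * (t - s) \<le> 0" if "h u \<le> ereal t" for u t
    using w[of "(u, t)"] that ws by (simp add: C_def inner_Pair)
  \<comment> \<open>Moving straight up from the projection stays in the epigraph, which fixes the
    sign of the vertical component of the normal.\<close>
  have "r - 1 - s \<le> 0"
    using sep[of b "s + 1"] bs by (simp add: order_trans[OF bs])
  \<comment> \<open>A vanishing vertical component would force \<open>a = b\<close>, and then
    \<open>h a\<close> would be at most \<open>r - 1\<close>.\<close>
  moreover have "r - 1 \<noteq> s"
  proof
    assume "r - 1 = s"
    with sep[of a r] a have "a = b" by (simp flip: power2_norm_eq_inner)
    with bs a \<open>r - 1 = s\<close> show False by simp
  qed
  ultimately have pos: "s - r + 1 > 0" by simp
  define p where "p = (1 / (s - r + 1)) *\<^sub>R (a - b)"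
  have p: "u \<bullet> p = (a - b) \<bullet> u / (s - r + 1)" for u
    by (simp add: p_def inner_commute)
  have "ereal (u \<bullet> p - (b \<bullet> p - s)) \<le> h u" for u
  proof (cases "h u")
    case (real t)
    have "(a - b) \<bullet> (u - b) \<le> (s - r + 1) * (t - s)"
      using sep[of u t] real by (simp add: algebra_simps)
    then have "(u - b) \<bullet> p \<le> t - s"
      using pos unfolding p by (simp add: field_simps)
    then show ?thesis using real by (simp add: inner_diff_left)
  qed (use h(1) in auto)
  then show ?thesis by (rule that)
qed

text \<open>One finite value of \<open>h\<close> bounds the conjugate from below everywhere, and the
  slope of an affine minorant is a point where the conjugate is finite.\<close>

lemma proper_conjugate:
  fixes h :: "'a::{real_inner, complete_space} \<Rightarrow> ereal"
  assumes "proper_convex_lsc h"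
  shows "proper (conjugate h)"
proof -
  obtain a r where a: "h a = ereal r"
    using assms by (metis proper_convex_lsc_def proper_def ereal_cases)
  have "ereal (a \<bullet> y - r) \<le> conjugate h y" for y
    unfolding conjugate_def using a by (intro SUP_upper2[of a]) auto
  then have "conjugate h y \<noteq> -\<infinity>" for y
    using MInfty_neq_ereal(1) ereal_infty_less_eq(2) by metis
  moreover obtain p c where pc: "\<And>u. ereal (u \<bullet> p - c) \<le> h u"
    using affine_minorant[OF assms] by blast
  have "ereal (u \<bullet> p) - h u \<le> ereal c" for u
    using pc[of u] by (cases "h u") auto
  then have "conjugate h p \<le> ereal c"
    unfolding conjugate_def by (intro SUP_least) auto
  then have "conjugate h p \<noteq> \<infinity>" by auto
  ultimately show ?thesis unfolding proper_def by blast
qed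

lemma convex_conjugate:
  assumes "proper h"
  shows "convex_ereal (conjugate h)"
  unfolding convex_ereal_def
proof (intro allI impI)
  fix a b and u v :: real
  assume uv: "0 \<le> u" "0 \<le> v" "u + v = 1"
  show "conjugate h (u *\<^sub>R a + v *\<^sub>R b) \<le> ereal u * conjugate h a + ereal v * conjugate h b"
    unfolding conjugate_def[of h "u *\<^sub>R a + v *\<^sub>R b"]
  proof (rule SUP_least)
    fix w
    have le: "ereal (w \<bullet> c) - h w \<le> conjugate h c" for c
      unfolding conjugate_def by (rule SUP_upper) simp
    show "ereal (w \<bullet> (u *\<^sub>R a + v *\<^sub>R b)) - h w
        \<le> ereal u * conjugate h a + ereal v * conjugate h b"
    proof (cases "h w")
      case (real r)
      have "w \<bullet> (u *\<^sub>R a + v *\<^sub>R b) - r = u * (w \<bullet> a - r) + v * (w \<bullet> b - r)"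
        using uv(3) by (simp add: inner_simps algebra_simps flip: distrib_left)
      then have "ereal (w \<bullet> (u *\<^sub>R a + v *\<^sub>R b)) - h w
          = ereal u * ereal (w \<bullet> a - r) + ereal v * ereal (w \<bullet> b - r)"
        using real by simp
      also have "\<dots> \<le> ereal u * conjugate h a + ereal v * conjugate h b"
        using le[of a] le[of b] real uv by (intro add_mono ereal_mult_left_mono) auto
      finally show ?thesis .
    qed (use assms in \<open>auto simp: proper_def\<close>)
  qed
qed

section \<open>Convex functions with Lipschitz gradient\<close>

lemma ereal_real_edom:
  assumes "proper f" "u \<in> edom f"
  shows "f u = ereal (real_of_ereal (f u))"
  using assms by (cases "f u") (auto simp: proper_def edom_def)

text \<open>The bridge from extended-valued convexity to \<open>convex_on\<close>, through which
  segment estimates and Jensen's inequality become available for real values.\<close>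

lemma convex_on_edom:
  fixes f :: "'a::real_vector \<Rightarrow> ereal"
  assumes "proper f" "convex_ereal f"
  shows "convex_on (edom f) (\<lambda>u. real_of_ereal (f u))"
proof -
  have le: "f (u *\<^sub>R a + v *\<^sub>R b)
      \<le> ereal (u * real_of_ereal (f a) + v * real_of_ereal (f b))"
    if "a \<in> edom f" "b \<in> edom f" "0 \<le> u" "0 \<le> v" "u + v = 1" for a b u v
  proof -
    have "f (u *\<^sub>R a + v *\<^sub>R b) \<le> ereal u * f a + ereal v * f b"
      using assms(2) that by (simp add: convex_ereal_def)
    also have "\<dots> = ereal (u * real_of_ereal (f a) + v * real_of_ereal (f b))"
      by (subst (1 2) ereal_real_edom[OF assms(1)]) (use that in auto)
    finally show ?thesis .
  qed
  have conv: "u *\<^sub>R a + v *\<^sub>R b \<in> edom f"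
    if "a \<in> edom f" "b \<in> edom f" "0 \<le> u" "0 \<le> v" "u + v = 1" for a b u v
    using le[OF that] by (auto simp: edom_def intro: le_less_trans)
  show ?thesis
    unfolding convex_on_def
  proof (intro conjI ballI allI impI)
    show "convex (edom f)" using conv by (intro convexI)
    fix a b and u v :: real
    assume *: "a \<in> edom f" "b \<in> edom f" "0 \<le> u" "0 \<le> v" "u + v = 1"
    show "real_of_ereal (f (u *\<^sub>R a + v *\<^sub>R b)) \<le> u * real_of_ereal (f a) + v * real_of_ereal (f b)"
      using le[OF *] ereal_real_edom[OF assms(1) conv[OF *]] by (metis ereal_less_eq(3))
  qed
qed

lemma GDERIV_line:
  assumes "GDERIV F (a + t *\<^sub>R d) :> p"
  shows "((\<lambda>s. F (a + s *\<^sub>R d)) has_real_derivative d \<bullet> p) (at t)"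
proof -
  have "((\<lambda>s. a + s *\<^sub>R d) has_derivative (\<lambda>s. s *\<^sub>R d)) (at t)"
    by (auto intro!: derivative_eq_intros)
  from has_derivative_compose[OF this assms[unfolded gderiv_def]]
  have "((\<lambda>s. F (a + s *\<^sub>R d)) has_derivative (\<lambda>s. (s *\<^sub>R d) \<bullet> p)) (at t)" .
  then show ?thesis
    by (rule has_derivative_imp_has_field_derivative) simp
qed

text \<open>By convexity the difference quotients along the segment from \<open>u\<close> to
  \<open>v\<close> are at most \<open>f v - f u\<close>; letting the step tend to 0 from the right
  gives the claim. Only \<open>u\<close> has to be an interior point of the domain.\<close>

lemma gradient_inequality:
  assumes f: "proper f" "convex_ereal f" and p: "has_gradient f u p" and v: "v \<in> edom f"
  shows "real_of_ereal (f u) + p \<bullet> (v - u) \<le> real_of_ereal (f v)"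
proof -
  let ?F = "\<lambda>w. real_of_ereal (f w)"
  have u: "u \<in> edom f" using p interior_subset by (auto simp: has_gradient_def)
  have "((\<lambda>s. ?F (u + s *\<^sub>R (v - u))) has_real_derivative (v - u) \<bullet> p) (at 0)"
    using p by (intro GDERIV_line) (simp add: has_gradient_def)
  then have "((\<lambda>s. (?F (u + s *\<^sub>R (v - u)) - ?F u) / s) \<longlongrightarrow> (v - u) \<bullet> p) (at 0)"
    by (simp add: has_field_derivative_iff)
  then have lim: "((\<lambda>s. (?F (u + s *\<^sub>R (v - u)) - ?F u) / s) \<longlongrightarrow> (v - u) \<bullet> p) (at_right 0)"
    by (rule tendsto_within_subset) simp
  have "(?F (u + s *\<^sub>R (v - u)) - ?F u) / s \<le> ?F v - ?F u" if "0 < s" "s < 1" for s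
  proof -
    have "?F ((1 - s) *\<^sub>R u + s *\<^sub>R v) \<le> (1 - s) * ?F u + s * ?F v"
      using convex_on_edom[OF f] u v that by (intro convex_onD) auto
    moreover have "(1 - s) *\<^sub>R u + s *\<^sub>R v = u + s *\<^sub>R (v - u)"
      by (simp add: algebra_simps)
    ultimately show ?thesis
      using that by (simp add: field_simps)
  qed
  then have "\<forall>\<^sub>F s in at_right 0. (?F (u + s *\<^sub>R (v - u)) - ?F u) / s \<le> ?F v - ?F u"
    by (auto simp: eventually_at_right_field intro!: exI[of _ 1])
  with lim have "(v - u) \<bullet> p \<le> ?F v - ?F u"
    by (rule tendsto_upperbound) simp
  then show ?thesis by (simp add: inner_commute)
qed

text \<open>The gradient inequality bounds \<open>f\<close> on bounded parts of its domain, so lower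
  semicontinuity makes the open set \<open>edom f\<close> closed.\<close>

lemma edom_lipschitz_gradient:
  fixes f :: "'a::real_inner \<Rightarrow> ereal"
  assumes f: "proper_convex_lsc f"
    and grad: "\<forall>u\<in>edom f. has_gradient f u (gradf u)"
    and lip: "\<forall>u\<in>edom f. \<forall>u'\<in>edom f. norm (gradf u - gradf u') \<le> Lf * norm (u - u')"
  shows "edom f = UNIV"
proof -
  have pc: "proper f" "convex_ereal f" "lsc f" using f by (auto simp: proper_convex_lsc_def)
  obtain a where a: "a \<in> edom f" using pc(1) by (auto simp: proper_def edom_def less_top)
  have "open (edom f)"
    using grad by (metis has_gradient_def interior_subset open_interior subsetI subset_antisym)
  have "c \<in> edom f" if c: "c \<in> closure (edom f)" for c
  proof (rule ccontr)
    assume "c \<notin> edom f"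
    define R where "R = norm (c - a) + 1"
    define B where "B = real_of_ereal (f a) + (norm (gradf a) + \<bar>Lf\<bar> * R) * R"
    \<comment> \<open>The gradient inequality at \<open>u\<close>, tested at the fixed point
      \<open>a\<close>, bounds \<open>f u\<close> from above. The Lipschitz bound controls
      \<open>gradf u\<close>, and \<open>R\<close> bounds the distance to \<open>a\<close> on the
      unit ball around \<open>c\<close>. The absolute value covers a negative
      \<open>Lf\<close>.\<close>
    have bound: "f u \<le> ereal B" if u: "u \<in> edom f" "dist u c < 1" for u
    proof -
      have R: "norm (u - a) \<le> R" "0 \<le> R"
        using norm_triangle_ineq[of "u - c" "c - a"] u(2) by (auto simp: R_def dist_norm)
      have "norm (gradf u - gradf a) \<le> Lf * norm (u - a)" using lip u a by blast
      also have "\<dots> \<le> \<bar>Lf\<bar> * R" using R by (intro mult_mono) auto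
      finally have g: "norm (gradf u) \<le> norm (gradf a) + \<bar>Lf\<bar> * R"
        using norm_triangle_ineq2[of "gradf u" "gradf a"] by linarith
      have "real_of_ereal (f u) \<le> real_of_ereal (f a) + gradf u \<bullet> (u - a)"
        using gradient_inequality[OF pc(1,2) _ a, of u "gradf u"] grad u(1)
        by (simp add: inner_diff_right)
      also have "gradf u \<bullet> (u - a) \<le> norm (gradf u) * norm (u - a)"
        by (rule norm_cauchy_schwarz)
      also have "\<dots> \<le> (norm (gradf a) + \<bar>Lf\<bar> * R) * R"
        using g R by (intro mult_mono) auto
      finally show ?thesis
        using ereal_real_edom[OF pc(1) u(1)] by (metis B_def add.commute add_le_cancel_left ereal_less_eq(3))
    qed
    \<comment> \<open>If \<open>f c\<close> were infinite, lower semicontinuity would push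
      \<open>f\<close> above \<open>B\<close> near \<open>c\<close>, although points of the domain
      accumulate there.\<close>
    have "ereal B < f c" using \<open>c \<notin> edom f\<close> by (simp add: edom_def)
    then have "\<forall>\<^sub>F u in nhds c. ereal B < f u \<and> dist u c < 1"
      using lsc_eventually[OF pc(3)] by (intro eventually_conj) (auto simp: eventually_nhds_metric intro: exI[of _ 1])
    then obtain r where "0 < r" and r: "\<And>u. dist u c < r \<Longrightarrow> ereal B < f u \<and> dist u c < 1"
      by (auto simp: eventually_nhds_metric)
    then obtain u where "u \<in> edom f" "dist u c < r"
      using c by (auto simp: closure_approachable)
    with bound r show False by (meson not_le)
  qed
  then have "closed (edom f)" by (metis closure_subset_eq subsetI)
  with \<open>open (edom f)\<close> a show ?thesis
    using clopen[of "edom f"] by blast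
qed

text \<open>Along the segment from \<open>u\<close> to \<open>v\<close>, subtracting the quadratic
  model from \<open>F\<close> leaves a function whose derivative is nonpositive by Cauchy-Schwarz
  and the Lipschitz bound, so no integration is involved.\<close>

lemma descent_lemma:
  fixes F :: "'a::real_inner \<Rightarrow> real"
  assumes grad: "\<And>u. GDERIV F u :> gradf u"
    and lip: "\<And>u u'. norm (gradf u - gradf u') \<le> Lf * norm (u - u')"
  shows "F v \<le> F u + gradf u \<bullet> (v - u) + Lf / 2 * (norm (v - u))\<^sup>2"
proof -
  define d where "d = v - u"
  define \<psi> where "\<psi> t = F (u + t *\<^sub>R d) - t * (gradf u \<bullet> d) - Lf / 2 * t\<^sup>2 * (norm d)\<^sup>2" for t
  have "\<psi> 1 \<le> \<psi> 0"
  proof (rule DERIV_nonpos_imp_nonincreasing[where f = \<psi>])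
    fix t :: real assume t: "0 \<le> t" "t \<le> 1"
    have "(\<psi> has_real_derivative d \<bullet> gradf (u + t *\<^sub>R d) - gradf u \<bullet> d - Lf * t * (norm d)\<^sup>2) (at t)"
      unfolding \<psi>_def using GDERIV_line[OF grad, of u d t]
      by (auto intro!: derivative_eq_intros)
    moreover have "(gradf (u + t *\<^sub>R d) - gradf u) \<bullet> d \<le> Lf * t * (norm d)\<^sup>2"
    proof -
      have "(gradf (u + t *\<^sub>R d) - gradf u) \<bullet> d \<le> norm (gradf (u + t *\<^sub>R d) - gradf u) * norm d"
        by (rule norm_cauchy_schwarz)
      also have "\<dots> \<le> Lf * norm (u + t *\<^sub>R d - u) * norm d"
        by (intro mult_right_mono lip) simp
      also have "\<dots> = Lf * t * (norm d)\<^sup>2"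
        using t by (simp add: power2_eq_square)
      finally show ?thesis .
    qed
    ultimately show "\<exists>D. (\<psi> has_real_derivative D) (at t) \<and> D \<le> 0"
      by (intro exI conjI) (auto simp: inner_diff inner_commute)
  qed simp
  then show ?thesis by (simp add: \<psi>_def d_def)
qed

section \<open>Inexact proximal points\<close>

lemma inexact_prox1_bound:
  assumes g: "proper g" "convex_ereal g" and "lam > 0" "eps \<ge> 0"
    and z: "inexact_prox1 eps lam g v z"
  shows "z \<in> edom g"
    and "u \<in> edom g \<Longrightarrow> real_of_ereal (g z) - real_of_ereal (g u)
      \<le> 1 / lam * ((v - z) \<bullet> (z - u)) + eps + sqrt (2 * lam * eps) / lam * norm (z - u)"
proof -
  let ?G = "\<lambda>w. real_of_ereal (g w)"
  have opt: "ereal (1 / (2 * lam) * (norm (z - v))\<^sup>2) + g z - ereal eps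
      \<le> ereal (1 / (2 * lam) * (norm (w - v))\<^sup>2) + g w" for w
    using z by (simp add: inexact_prox1_def eps_subdifferential_def prox_objective_def)
  show zd: "z \<in> edom g"
  proof (rule ccontr)
    assume "z \<notin> edom g"
    then have "g z = \<infinity>" by (simp add: edom_def)
    with opt have "g w = \<infinity>" for w using g(1) by (auto simp: proper_def dest!: spec[of _ w])
    with g(1) show False by (simp add: proper_def)
  qed
  assume u: "u \<in> edom g"
  \<comment> \<open>\<open>k\<close> is the distance scale set by the tolerance: beyond it the test
    point is taken inside the segment, below it \<open>u\<close> itself serves.\<close>
  define d where "d = norm (z - u)"
  define k where "k = sqrt (2 * lam * eps)"
  have k: "k \<ge> 0" "k * k = 2 * lam * eps"
    using assms by (simp_all add: k_def)
  have "d \<ge> 0" by (simp add: d_def)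
  define D where "D = ?G z - ?G u - 1 / lam * ((v - z) \<bullet> (z - u))"
  \<comment> \<open>Comparing \<open>z\<close> with the point at fraction \<open>s\<close> towards
    \<open>u\<close> and dividing by \<open>s\<close>: the tolerance is amplified to
    \<open>eps / s\<close>, while the quadratic term shrinks with \<open>s\<close>.\<close>
  have key: "D \<le> eps / s + s * d\<^sup>2 / (2 * lam)" if "0 < s" "s \<le> 1" for s
  proof -
    define w where "w = (1 - s) *\<^sub>R z + s *\<^sub>R u"
    have wd: "w \<in> edom g"
      unfolding w_def using convex_on_imp_convex[OF convex_on_edom[OF g]] zd u that
      by (intro convexD) auto
    have Gw: "?G w \<le> (1 - s) * ?G z + s * ?G u"
      unfolding w_def using convex_on_edom[OF g] zd u that by (intro convex_onD) auto
    have "1 / (2 * lam) * (norm (z - v))\<^sup>2 + ?G z - eps \<le> 1 / (2 * lam) * (norm (w - v))\<^sup>2 + ?G w"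
      using opt[of w] ereal_real_edom[OF g(1) zd] ereal_real_edom[OF g(1) wd]
      by (metis ereal_less_eq(3) ereal_minus(1) plus_ereal.simps(1))
    moreover have "(norm (w - v))\<^sup>2 = (norm (z - v))\<^sup>2 + 2 * s * ((v - z) \<bullet> (z - u)) + s\<^sup>2 * d\<^sup>2"
      unfolding w_def d_def power2_norm_eq_inner
      by (simp add: inner_simps inner_commute algebra_simps power2_eq_square)
    moreover from calculation(2) have "1 / (2 * lam) * (norm (w - v))\<^sup>2 = 1 / (2 * lam) * (norm (z - v))\<^sup>2
        + s / lam * ((v - z) \<bullet> (z - u)) + s\<^sup>2 * d\<^sup>2 / (2 * lam)"
      using \<open>lam > 0\<close> by (simp add: field_simps)
    ultimately have "s * ?G z - s * ?G u \<le> s / lam * ((v - z) \<bullet> (z - u)) + eps + s\<^sup>2 * d\<^sup>2 / (2 * lam)"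
      using Gw by (simp add: left_diff_distrib)
    then have "s * D \<le> s * (eps / s + s * d\<^sup>2 / (2 * lam))"
      using that by (simp add: D_def algebra_simps power2_eq_square)
    then show ?thesis using that by simp
  qed
  have "D \<le> eps + k / lam * d"
  proof (cases "d \<le> k")
    case True
    have "d * d \<le> k * d" using True \<open>d \<ge> 0\<close> by (intro mult_right_mono)
    then have "d\<^sup>2 / (2 * lam) \<le> k * d / (2 * lam)"
      using \<open>lam > 0\<close> by (simp add: power2_eq_square divide_right_mono)
    also have "\<dots> \<le> k / lam * d"
      using \<open>lam > 0\<close> \<open>d \<ge> 0\<close> k by (simp add: field_simps)
    finally show ?thesis using key[of 1] by simp
  next
    case False
    show ?thesis
    proof (cases "k = 0")
      case True
      with k assms have "eps = 0" by simp
      define c where "c = d\<^sup>2 / (2 * lam)"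
      have c: "D \<le> s * c" if "0 < s" "s \<le> 1" for s
        using key[OF that] \<open>eps = 0\<close> by (simp add: c_def)
      \<comment> \<open>Here the prox is exact and \<open>s\<close> may tend to 0. A positive
        \<open>D\<close> is refuted by \<open>s = D / (2 * c)\<close>, which is at most 1/2 by the
        case \<open>s = 1\<close>.\<close>
      have "D \<le> 0"
      proof (rule ccontr)
        assume "\<not> D \<le> 0"
        with c[of 1] c[of "D / (2 * c)"] show False by (simp add: field_simps)
      qed
      then show ?thesis using \<open>eps = 0\<close> True by simp
    next
      case nz: False
      then have "0 < k" "k < d" using k False by auto
      \<comment> \<open>The choice \<open>s = k / d\<close> balances the two error terms, since
        \<open>k * k = 2 * lam * eps\<close>.\<close>
      have "eps / (k / d) = k * d / (2 * lam)"
        using \<open>0 < k\<close> \<open>k < d\<close> k(2) \<open>lam > 0\<close> by (simp add: field_simps)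
      moreover have "k / d * d\<^sup>2 / (2 * lam) = k * d / (2 * lam)"
        using \<open>k < d\<close> \<open>0 < k\<close> by (simp add: power2_eq_square)
      ultimately have "D \<le> k / lam * d"
        using key[of "k / d"] \<open>0 < k\<close> \<open>k < d\<close> by (simp add: field_simps)
      then show ?thesis using assms by simp
    qed
  qed
  then show "?G z - ?G u \<le> 1 / lam * ((v - z) \<bullet> (z - u)) + eps
      + sqrt (2 * lam * eps) / lam * norm (z - u)"
    by (simp add: D_def d_def k_def)
qed

lemma inexact_prox2_bound:
  assumes g: "proper g" and z: "inexact_prox2 eps lam g v z"
  shows "z \<in> edom g"
    and "u \<in> edom g \<Longrightarrow> real_of_ereal (g z) - real_of_ereal (g u)
      \<le> 1 / lam * ((v - z) \<bullet> (z - u)) + eps"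
proof -
  have sub: "g z + ereal ((1 / lam) *\<^sub>R (v - z) \<bullet> (w - z)) - ereal eps \<le> g w" for w
    using z by (simp add: inexact_prox2_def eps_subdifferential_def)
  show zd: "z \<in> edom g"
  proof (rule ccontr)
    assume "z \<notin> edom g"
    then have "g z = \<infinity>" by (simp add: edom_def)
    with sub have "g w = \<infinity>" for w by (auto dest!: spec[of _ w])
    with g show False by (simp add: proper_def)
  qed
  assume u: "u \<in> edom g"
  have "real_of_ereal (g z) + (1 / lam) *\<^sub>R (v - z) \<bullet> (u - z) - eps \<le> real_of_ereal (g u)"
    using sub[of u] ereal_real_edom[OF g zd] ereal_real_edom[OF g u]
    by (metis ereal_less_eq(3) ereal_minus(1) plus_ereal.simps(1))
  moreover have "(v - z) \<bullet> (u - z) = - ((v - z) \<bullet> (z - u))"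
    by (simp add: inner_diff_right)
  ultimately show "real_of_ereal (g z) - real_of_ereal (g u)
      \<le> 1 / lam * ((v - z) \<bullet> (z - u)) + eps"
    by simp
qed

lemma prox_imp_inexact_prox1:
  assumes "z \<in> prox lam g v"
  shows "inexact_prox1 0 lam g v z"
  using assms
  by (auto simp: prox_def is_arg_min_def inexact_prox1_def eps_subdifferential_def not_less
      simp flip: zero_ereal_def)

text \<open>A type 3 point is an exact prox of a shifted argument, so the only error is
  \<open>r \<bullet> (z - u) / lam\<close>; it is linear in the distance, with no additive
  tolerance.\<close>

lemma inexact_prox3_bound:
  assumes g: "proper g" "convex_ereal g" and "lam > 0"
    and z: "inexact_prox3 eps lam g v z"
  shows "z \<in> edom g"
    and "u \<in> edom g \<Longrightarrow> real_of_ereal (g z) - real_of_ereal (g u)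
      \<le> 1 / lam * ((v - z) \<bullet> (z - u)) + sqrt (2 * lam * eps) / lam * norm (z - u)"
proof -
  obtain r where r: "norm r \<le> sqrt (2 * lam * eps)" and "z \<in> prox lam g (v + r)"
    using z by (auto simp: inexact_prox3_def)
  then have z1: "inexact_prox1 0 lam g (v + r) z" by (intro prox_imp_inexact_prox1)
  show "z \<in> edom g" by (rule inexact_prox1_bound(1)[OF g _ _ z1]) (use assms in auto)
  assume "u \<in> edom g"
  then have "real_of_ereal (g z) - real_of_ereal (g u) \<le> 1 / lam * ((v + r - z) \<bullet> (z - u))"
    using inexact_prox1_bound(2)[OF g \<open>lam > 0\<close> _ z1] by simp
  moreover have "(v + r - z) \<bullet> (z - u) = (v - z) \<bullet> (z - u) + r \<bullet> (z - u)"
    by (simp add: inner_simps)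
  moreover have "r \<bullet> (z - u) \<le> sqrt (2 * lam * eps) * norm (z - u)"
    using norm_cauchy_schwarz[of r "z - u"] mult_right_mono[OF r, of "norm (z - u)"] by simp
  ultimately show "real_of_ereal (g z) - real_of_ereal (g u)
      \<le> 1 / lam * ((v - z) \<bullet> (z - u)) + sqrt (2 * lam * eps) / lam * norm (z - u)"
    using \<open>lam > 0\<close> by (simp add: field_simps)
qed

text \<open>The three types are merged into one inequality with an additive and a linear error. The
  case distinctions match \<open>err_B\<close> and \<open>err_A\<close>: additive errors accumulate
  under the square root, linear ones enter the sum \<open>A\<close>.\<close>

lemma inexact_prox_bound:
  assumes g: "proper g" "convex_ereal g" and "lam > 0" "eps \<ge> 0"
    and z: "inexact_prox i eps lam g v z" and i: "i \<in> {1, 2, 3}"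
  shows "z \<in> edom g"
    and "u \<in> edom g \<Longrightarrow> real_of_ereal (g z) - real_of_ereal (g u)
      \<le> 1 / lam * ((v - z) \<bullet> (z - u)) + (if i = 3 then 0 else eps)
        + (if i = 2 then 0 else sqrt (2 * lam * eps)) / lam * norm (z - u)"
proof -
  consider "i = 1" "inexact_prox1 eps lam g v z" | "i = 2" "inexact_prox2 eps lam g v z"
    | "i = 3" "inexact_prox3 eps lam g v z"
    using i z by (auto simp: inexact_prox_def)
  note cases = this
  from cases show "z \<in> edom g"
    using inexact_prox1_bound(1)[OF g assms(3,4)] inexact_prox2_bound(1)[OF g(1)]
      inexact_prox3_bound(1)[OF g assms(3)]
    by metis
  assume u: "u \<in> edom g"
  from cases show "real_of_ereal (g z) - real_of_ereal (g u)
      \<le> 1 / lam * ((v - z) \<bullet> (z - u)) + (if i = 3 then 0 else eps)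
        + (if i = 2 then 0 else sqrt (2 * lam * eps)) / lam * norm (z - u)"
  proof cases
    case 1
    then show ?thesis using inexact_prox1_bound(2)[OF g assms(3,4) 1(2) u] by simp
  next
    case 2
    then show ?thesis using inexact_prox2_bound(2)[OF g(1) 2(2) u] by simp
  next
    case 3
    then show ?thesis using inexact_prox3_bound(2)[OF g assms(3) 3(2) u] by simp
  qed
qed

section \<open>The primal-dual iteration\<close>

text \<open>At the index of the largest \<open>u\<close>, dropping \<open>T\<close> leaves the
  quadratic inequality \<open>U^2 \<le> R^2 + 2 * A * U\<close>, hence
  \<open>U \<le> 2 * A + R\<close>. Inserting this at \<open>N\<close> bounds \<open>T N\<close>.
  The recursion is therefore required at every index up to \<open>N\<close>.\<close>

lemma quadratic_recursion:
  fixes u \<alpha> T B :: "nat \<Rightarrow> real"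
  assumes rec: "\<And>n. n \<le> N \<Longrightarrow> T n + (u n)\<^sup>2 \<le> p\<^sup>2 + q\<^sup>2 + 2 * B n + 2 * (\<Sum>k=1..n. \<alpha> k * u k)"
    and nonneg: "\<And>n. u n \<ge> 0" "\<And>n. T n \<ge> 0" "\<And>n. n \<ge> 1 \<Longrightarrow> \<alpha> n \<ge> 0" "p \<ge> 0" "q \<ge> 0" "B 0 \<ge> 0"
    and mono: "mono B"
  shows "T N \<le> (p + q + 2 * (\<Sum>k=1..N. \<alpha> k) + sqrt (2 * B N))\<^sup>2"
proof -
  define A where "A = (\<Sum>k=1..N. \<alpha> k)"
  define U where "U = Max (u ` {..N})"
  define R where "R = p + q + sqrt (2 * B N)"
  have u_le: "u n \<le> U" if "n \<le> N" for n
    unfolding U_def using that by (intro Max_ge) auto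
  have "U \<in> u ` {..N}" unfolding U_def by (intro Max_in) auto
  then obtain m where m: "m \<le> N" "u m = U" by auto
  have "U \<ge> 0" using m nonneg(1) by metis
  have "A \<ge> 0" unfolding A_def using nonneg(3) by (intro sum_nonneg) auto
  have BN: "B N \<ge> 0" using monoD[OF mono, of 0 N] nonneg(6) by simp
  have R: "R \<ge> 0" using nonneg BN by (simp add: R_def)
  \<comment> \<open>A sum of squares of nonnegative numbers is at most the square of their
    sum.\<close>
  have "p\<^sup>2 + q\<^sup>2 + (sqrt (2 * B N))\<^sup>2 \<le> R\<^sup>2"
    using nonneg BN by (simp add: R_def power2_eq_square algebra_simps)
  then have S: "p\<^sup>2 + q\<^sup>2 + 2 * B N \<le> R\<^sup>2" using BN by simp
  have bound: "T n + (u n)\<^sup>2 \<le> R\<^sup>2 + 2 * A * U" if "n \<le> N" for n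
  proof -
    have "(\<Sum>k=1..n. \<alpha> k * u k) \<le> (\<Sum>k=1..n. \<alpha> k * U)"
      using nonneg u_le that by (intro sum_mono mult_left_mono) auto
    also have "\<dots> \<le> (\<Sum>k=1..N. \<alpha> k * U)"
      using nonneg(3) \<open>U \<ge> 0\<close> that by (intro sum_mono2) auto
    also have "\<dots> = A * U" by (simp add: A_def sum_distrib_right)
    finally show ?thesis
      using rec[OF that] S monoD[OF mono that] by simp
  qed
  have "U \<le> 2 * A + R"
  proof (rule ccontr)
    assume "\<not> ?thesis"
    then have U: "U > 2 * A + R" by simp
    then have "(2 * A + R) * U < U * U" using \<open>A \<ge> 0\<close> R by (intro mult_strict_right_mono) auto
    moreover have "R * R \<le> R * U" using U \<open>A \<ge> 0\<close> R by (intro mult_left_mono) auto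
    ultimately show False
      using bound[OF m(1)] m(2) nonneg(2)[of m] by (simp add: power2_eq_square algebra_simps)
  qed
  then have "2 * A * U \<le> 2 * A * (2 * A + R)" using \<open>A \<ge> 0\<close> by (intro mult_left_mono) auto
  then have "T N \<le> R\<^sup>2 + 2 * A * (2 * A + R)"
    using bound[of N] by (smt (verit) order_refl zero_le_power2)
  also have "\<dots> \<le> (2 * A + R)\<^sup>2"
    using \<open>A \<ge> 0\<close> R by (simp add: power2_eq_square algebra_simps)
  finally show ?thesis by (simp add: A_def R_def algebra_simps)
qed

lemma inner_three_point:
  fixes a b c :: "'a::real_inner"
  shows "(a - b) \<bullet> (b - c) = ((norm (a - c))\<^sup>2 - (norm (b - c))\<^sup>2 - (norm (b - a))\<^sup>2) / 2"
  by (simp add: power2_norm_eq_inner inner_simps inner_commute algebra_simps)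

lemma young_inner:
  fixes u v :: "'a::real_inner"
  assumes "\<sigma> > 0"
  shows "u \<bullet> v \<le> \<sigma> / 2 * (norm u)\<^sup>2 + (norm v)\<^sup>2 / (2 * \<sigma>)"
proof -
  have "0 \<le> (norm (\<sigma> *\<^sub>R u - v))\<^sup>2" by simp
  also have "\<dots> = \<sigma>\<^sup>2 * (norm u)\<^sup>2 + (norm v)\<^sup>2 - 2 * \<sigma> * (u \<bullet> v)"
    unfolding power2_norm_eq_inner
    by (simp add: inner_simps inner_commute algebra_simps power2_eq_square)
  finally show ?thesis
    using assms by (simp add: field_simps power2_eq_square)
qed

text \<open>The cross terms \<open>K (x n - x (n - 1)) \<bullet> (y n - ys)\<close> telescope thanks to the
  extrapolation. The remainder \<open>K (x n - x (n - 1)) \<bullet> (y (n + 1) - y n)\<close> is absorbed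
  by the proximal terms.\<close>

lemma primal_dual_energy:
  fixes K :: "'a::real_inner \<Rightarrow> 'b::real_inner"
  assumes K: "bounded_linear K" "\<And>d. norm (K d) \<le> L * norm d"
    and pos: "\<tau> > 0" "\<sigma> > 0" and cond: "\<tau> * Lf + \<sigma> * \<tau> * L\<^sup>2 \<le> 1"
    and step: "\<And>n. gap (n + 1)
      \<le> 1 / \<tau> * ((x n - x (n + 1)) \<bullet> (x (n + 1) - xs))
        + 1 / \<sigma> * ((y n - y (n + 1)) \<bullet> (y (n + 1) - ys))
        + Lf / 2 * (norm (x (n + 1) - x n))\<^sup>2 + err (n + 1)
        - K (x (n + 1) - extrapolate x n) \<bullet> (y (n + 1) - ys)"
  shows "(\<Sum>n=1..N. gap n) + (norm (x N - xs))\<^sup>2 / (2 * \<tau>)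
      \<le> (norm (x 0 - xs))\<^sup>2 / (2 * \<tau>) + (norm (y 0 - ys))\<^sup>2 / (2 * \<sigma>) + (\<Sum>n=1..N. err n)"
proof -
  interpret K: bounded_linear K by (rule K(1))
  have K_sq: "\<sigma> / 2 * (norm (K d))\<^sup>2 \<le> \<sigma> * L\<^sup>2 / 2 * (norm d)\<^sup>2" for d
    using power_mono[OF K(2)[of d], of 2] pos by (simp add: power_mult_distrib mult_left_mono)
  have cond': "\<sigma> * L\<^sup>2 / 2 \<le> 1 / (2 * \<tau>) - Lf / 2"
    using cond pos by (simp add: field_simps)
  \<comment> \<open>The last summand pays for the Young bound of the next remainder, and the
    step-size condition lets the primal proximal term replenish it. Since \<open>0 - 1 = 0\<close>
    on the naturals, the last two summands vanish at \<open>n = 0\<close>.\<close>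
  define E where "E n = (norm (x n - xs))\<^sup>2 / (2 * \<tau>) + (norm (y n - ys))\<^sup>2 / (2 * \<sigma>)
      + K (x n - x (n - 1)) \<bullet> (y n - ys) + \<sigma> * L\<^sup>2 / 2 * (norm (x n - x (n - 1)))\<^sup>2" for n
  have E_step: "gap (n + 1) + E (n + 1) \<le> E n + err (n + 1)" for n
  proof -
    let ?d = "x n - x (n - 1)" and ?d' = "x (n + 1) - x n"
    have cross: "K (x (n + 1) - extrapolate x n) \<bullet> (y (n + 1) - ys)
        = K ?d' \<bullet> (y (n + 1) - ys) - K ?d \<bullet> (y n - ys) - K ?d \<bullet> (y (n + 1) - y n)"
      unfolding extrapolate_def
      by (simp add: K.add K.diff K.scaleR inner_simps algebra_simps)
    have "K ?d \<bullet> (y (n + 1) - y n)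
        \<le> \<sigma> * L\<^sup>2 / 2 * (norm ?d)\<^sup>2 + (norm (y (n + 1) - y n))\<^sup>2 / (2 * \<sigma>)"
      using young_inner[OF pos(2), of "K ?d" "y (n + 1) - y n"] K_sq[of ?d] by simp
    moreover have "\<sigma> * L\<^sup>2 / 2 * (norm ?d')\<^sup>2 \<le> (1 / (2 * \<tau>) - Lf / 2) * (norm ?d')\<^sup>2"
      using cond' by (intro mult_right_mono) auto
    moreover have "1 / \<tau> * ((x n - x (n + 1)) \<bullet> (x (n + 1) - xs))
        = (norm (x n - xs))\<^sup>2 / (2 * \<tau>) - (norm (x (n + 1) - xs))\<^sup>2 / (2 * \<tau>)
          - 1 / (2 * \<tau>) * (norm ?d')\<^sup>2"
      unfolding inner_three_point using pos by (simp add: field_simps)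
    moreover have "1 / \<sigma> * ((y n - y (n + 1)) \<bullet> (y (n + 1) - ys))
        = (norm (y n - ys))\<^sup>2 / (2 * \<sigma>) - (norm (y (n + 1) - ys))\<^sup>2 / (2 * \<sigma>)
          - (norm (y (n + 1) - y n))\<^sup>2 / (2 * \<sigma>)"
      unfolding inner_three_point using pos by (simp add: field_simps)
    ultimately show ?thesis
      using step[of n] cross by (simp add: E_def left_diff_distrib)
  qed
  have "(\<Sum>n=1..N. gap n) + E N \<le> E 0 + (\<Sum>n=1..N. err n)"
  proof (induction N)
    case (Suc N)
    then show ?case using E_step[of N] by simp
  qed simp
  moreover have "E 0 = (norm (x 0 - xs))\<^sup>2 / (2 * \<tau>) + (norm (y 0 - ys))\<^sup>2 / (2 * \<sigma>)"
    by (simp add: E_def K.zero)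
  \<comment> \<open>Young's inequality absorbs a negative cross term into the dual distance and the
    last summand of \<open>E N\<close>.\<close>
  moreover have "(norm (x N - xs))\<^sup>2 / (2 * \<tau>) \<le> E N"
    using young_inner[OF pos(2), of "K (x N - x (N - 1))" "- (y N - ys)"] K_sq[of "x N - x (N - 1)"]
    by (simp add: E_def del: minus_diff_eq)
  ultimately show ?thesis by simp
qed

section \<open>Ergodic means and finiteness at saddle points\<close>

lemma convex_ergodic_mean:
  assumes "proper g" "convex_ereal g" "N \<ge> 1" and x: "\<And>n. n \<ge> 1 \<Longrightarrow> x n \<in> edom g"
  shows "ergodic_mean x N \<in> edom g"
    and "real N * real_of_ereal (g (ergodic_mean x N)) \<le> (\<Sum>n=1..N. real_of_ereal (g (x n)))"
proof -
  have mean: "ergodic_mean x N = (\<Sum>n=1..N. (1 / real N) *\<^sub>R x n)"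
    by (simp add: ergodic_mean_def scaleR_sum_right)
  have one: "(\<Sum>n=1..N. 1 / real N) = 1" using \<open>N \<ge> 1\<close> by simp
  note conv = convex_on_edom[OF assms(1,2)]
  show "ergodic_mean x N \<in> edom g"
    unfolding mean using convex_on_imp_convex[OF conv] x one by (intro convex_sum) auto
  have "real_of_ereal (g (ergodic_mean x N)) \<le> (\<Sum>n=1..N. 1 / real N * real_of_ereal (g (x n)))"
    unfolding mean using conv x one \<open>N \<ge> 1\<close> by (intro convex_on_sum[of _ "edom g"]) auto
  also have "\<dots> = (\<Sum>n=1..N. real_of_ereal (g (x n))) / real N"
    by (simp add: sum_divide_distrib)
  finally show "real N * real_of_ereal (g (ergodic_mean x N)) \<le> (\<Sum>n=1..N. real_of_ereal (g (x n)))"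
    using \<open>N \<ge> 1\<close> by (simp add: field_simps)
qed

lemma inner_ergodic_mean:
  assumes "linear K" "N \<ge> 1"
  shows "real N * (K (ergodic_mean x N) \<bullet> v) = (\<Sum>n=1..N. K (x n) \<bullet> v)"
    and "real N * (w \<bullet> ergodic_mean y N) = (\<Sum>n=1..N. w \<bullet> y n)"
  using assms
  by (simp_all add: ergodic_mean_def linear_scale linear_sum inner_sum_left inner_sum_right)

text \<open>Comparing with points \<open>a\<close>, \<open>b\<close> of finite value, the saddle
  inequalities chain to \<open>L xs b \<le> L a ys\<close>. A coordinate outside its domain would
  make the left side infinite or the right side minus infinity, while the other side cannot match
  it. Each evaluated Lagrangian contains a finite value on one side of the subtraction, so
  \<open>\<infinity> - \<infinity>\<close> never arises.\<close>

lemma saddle_point_in_domain: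
  assumes f: "proper f" "edom f = UNIV" and g: "proper g" and hs: "proper (conjugate h)"
    and saddle: "saddle_point (Lagrangian K f g h) xs ys"
  shows "xs \<in> edom g" and "ys \<in> edom (conjugate h)"
proof -
  obtain a b where a: "g a \<noteq> \<infinity>" "g a \<noteq> -\<infinity>" and b: "conjugate h b \<noteq> \<infinity>" "conjugate h b \<noteq> -\<infinity>"
    using g hs by (auto simp: proper_def)
  have fin: "f u \<noteq> \<infinity>" "f u \<noteq> -\<infinity>" "g u \<noteq> -\<infinity>" for u
    using f g by (auto simp: proper_def edom_def)
  have fin_h: "conjugate h ys \<noteq> -\<infinity>" using hs by (simp add: proper_def)
  have le: "Lagrangian K f g h xs b \<le> Lagrangian K f g h a ys"
    using saddle by (meson order_trans saddle_point_def)
  obtain r r' s t where r: "f xs = ereal r" and r': "f a = ereal r'" and s: "g a = ereal s"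
    and t: "conjugate h b = ereal t"
    using fin a b by (metis ereal_cases)
  show "xs \<in> edom g"
  proof (rule ccontr)
    assume "xs \<notin> edom g"
    then have "Lagrangian K f g h xs b = \<infinity>"
      by (simp add: Lagrangian_def edom_def r t)
    moreover have "Lagrangian K f g h a ys \<noteq> \<infinity>"
      using fin_h by (cases "conjugate h ys") (simp_all add: Lagrangian_def r' s)
    ultimately show False using le by simp
  qed
  show "ys \<in> edom (conjugate h)"
  proof (rule ccontr)
    assume "ys \<notin> edom (conjugate h)"
    then have "Lagrangian K f g h a ys = -\<infinity>"
      by (simp add: Lagrangian_def edom_def r' s)
    moreover have "Lagrangian K f g h xs b \<noteq> -\<infinity>"
      using fin(3)[of xs] by (cases "g xs") (simp_all add: Lagrangian_def r t)
    ultimately show False using le by simp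
  qed
qed

lemma Lagrangian_eq_ereal:
  assumes "proper f" "proper g" "proper (conjugate h)"
    and "u \<in> edom f" "u \<in> edom g" "v \<in> edom (conjugate h)"
  shows "Lagrangian K f g h u v = ereal (K u \<bullet> v + real_of_ereal (f u) + real_of_ereal (g u)
      - real_of_ereal (conjugate h v))"
  unfolding Lagrangian_def
  using assms(4-6)[THEN ereal_real_edom[rotated]] assms(1-3)
  by (metis ereal_minus(1) plus_ereal.simps(1))

theorem theorem3p2:
  fixes K :: "'a::{real_inner, complete_space} \<Rightarrow> 'b::{real_inner, complete_space}"
    and f g :: "'a \<Rightarrow> ereal" and h :: "'b \<Rightarrow> ereal"
    and gradf :: "'a \<Rightarrow> 'a"
    and L Lf \<beta> \<tau> \<sigma> :: real
    and i N :: nat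
    and x e :: "nat \<Rightarrow> 'a" and y :: "nat \<Rightarrow> 'b"
    and \<epsilon> \<delta> :: "nat \<Rightarrow> real"
    and xstar :: 'a and ystar :: 'b
  assumes "bounded_linear K"
    and "proper_convex_lsc f" and "proper_convex_lsc g" and "proper_convex_lsc h"
    and "\<forall>u\<in>edom f. has_gradient f u (gradf u)"
    and "\<forall>u\<in>edom f. \<forall>u'\<in>edom f. norm (gradf u - gradf u') \<le> Lf * norm (u - u')"
    and "L = onorm K"
    and "\<beta> > 0" and "\<tau> > 0" and "\<sigma> > 0"
    and "\<tau> * Lf + \<sigma> * \<tau> * L\<^sup>2 + \<tau> * \<beta> * L < 1"
    and "i \<in> {1, 2, 3}"
    and "\<forall>n\<ge>1. \<epsilon> n \<ge> 0" and "\<forall>n\<ge>1. \<delta> n \<ge> 0"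
    and "\<forall>n. inexact_prox2 (\<delta> (n + 1)) \<sigma> (conjugate h)
               (y n + \<sigma> *\<^sub>R K (extrapolate x n)) (y (n + 1))"
    and "\<forall>n. inexact_prox i (\<epsilon> (n + 1)) \<tau> g
               (x n - \<tau> *\<^sub>R (adjoint K (y (n + 1)) + gradf (x n) + e (n + 1))) (x (n + 1))"
    and "N \<ge> 1"
    and "saddle_point (Lagrangian K f g h) xstar ystar"
  shows "Lagrangian K f g h (ergodic_mean x N) ystar
           - Lagrangian K f g h xstar (ergodic_mean y N)
         \<le> ereal (1 / (2 * \<tau> * real N) *
             (norm (xstar - x 0) + sqrt (\<tau> / \<sigma>) * norm (ystar - y 0)
              + 2 * err_A i \<tau> e \<epsilon> N + sqrt (2 * err_B i \<tau> \<epsilon> \<delta> N))\<^sup>2)"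
proof -
  note pos = \<open>\<tau> > 0\<close> \<open>\<sigma> > 0\<close>
  interpret K: bounded_linear K by fact
  let ?h = "conjugate h"
  define F where "F u = real_of_ereal (f u)" for u
  define G where "G u = real_of_ereal (g u)" for u
  define H where "H v = real_of_ereal (?h v)" for v
  have f: "proper f" "convex_ereal f" and g: "proper g" "convex_ereal g"
    using assms(2,3) by (auto simp: proper_convex_lsc_def)
  have hs: "proper ?h" "convex_ereal ?h"
    using assms(4) proper_conjugate convex_conjugate by (auto simp: proper_convex_lsc_def)
  \<comment> \<open>The iterates are known to lie only in the domain of \<open>g\<close>, and
    \<open>x 0\<close> is arbitrary; finiteness of \<open>f\<close> everywhere makes the gradient
    bounds available at each of them.\<close>
  have dom_f: "edom f = UNIV"
    by (rule edom_lipschitz_gradient[OF assms(2,5,6)])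
  have descent: "F v \<le> F u + gradf u \<bullet> (v - u) + Lf / 2 * (norm (v - u))\<^sup>2" for u v
    unfolding F_def using assms(5,6) by (intro descent_lemma) (auto simp: has_gradient_def dom_f)
  have grad: "F u - F w \<le> gradf u \<bullet> (u - w)" for u w
    using gradient_inequality[OF f, of u "gradf u" w] assms(5)
    by (simp add: F_def dom_f inner_diff_right)
  have xsd: "xstar \<in> edom g" and ysd: "ystar \<in> edom ?h"
    using saddle_point_in_domain[OF f(1) dom_f g(1) hs(1) assms(18)] by auto

  define a where "a n = (if i = 2 then 0 else sqrt (2 * \<tau> * \<epsilon> n))" for n
  define b where "b n = (if i = 3 then 0 else \<epsilon> n)" for n
  have ab: "a n \<ge> 0" "b n \<ge> 0" if "n \<ge> 1" for n
    using that assms(13) pos by (auto simp: a_def b_def)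
  define \<alpha> where "\<alpha> n = \<tau> * norm (e n) + a n" for n
  have prox_x: "x (n + 1) \<in> edom g"
    "G (x (n + 1)) - G u \<le> 1 / \<tau> * ((x n - \<tau> *\<^sub>R (adjoint K (y (n + 1)) + gradf (x n) + e (n + 1))
        - x (n + 1)) \<bullet> (x (n + 1) - u)) + b (n + 1) + a (n + 1) / \<tau> * norm (x (n + 1) - u)"
    if "u \<in> edom g" for n u
    using inexact_prox_bound[OF g pos(1) _ assms(16)[rule_format, of n] assms(12)] assms(13) that
    by (auto simp: G_def a_def b_def)
  have prox_y: "y (n + 1) \<in> edom ?h"
    "H (y (n + 1)) - H v \<le> 1 / \<sigma> * ((y n + \<sigma> *\<^sub>R K (extrapolate x n) - y (n + 1))
        \<bullet> (y (n + 1) - v)) + \<delta> (n + 1)" if "v \<in> edom ?h" for n v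
    using inexact_prox2_bound[OF hs(1) assms(15)[rule_format, of n]] that by (auto simp: H_def)
  have xd: "x n \<in> edom g" and yd: "y n \<in> edom ?h" if "n \<ge> 1" for n
    using prox_x(1)[OF xsd, of "n - 1"] prox_y(1)[OF ysd, of "n - 1"] that by auto
  define \<Lambda> where "\<Lambda> u v = K u \<bullet> v + F u + G u - H v" for u v
  have Lag: "Lagrangian K f g h u v = ereal (\<Lambda> u v)" if "u \<in> edom g" "v \<in> edom ?h" for u v
    using Lagrangian_eq_ereal[OF f(1) g(1) hs(1)] that dom_f by (simp add: \<Lambda>_def F_def G_def H_def)
  define gap where "gap n = \<Lambda> (x n) ystar - \<Lambda> xstar (y n)" for n
  \<comment> \<open>Both saddle inequalities chain through the value at the saddle point.\<close>
  have gap_nonneg: "gap n \<ge> 0" if "n \<ge> 1" for n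
  proof -
    have "Lagrangian K f g h xstar (y n) \<le> Lagrangian K f g h (x n) ystar"
      using assms(18) by (meson order_trans saddle_point_def)
    then show ?thesis
      using Lag xd[OF that] yd[OF that] xsd ysd by (simp add: gap_def)
  qed
  define err where "err n = b n + \<delta> n + \<alpha> n / \<tau> * norm (x n - xstar)" for n
  have step: "gap (n + 1)
      \<le> 1 / \<tau> * ((x n - x (n + 1)) \<bullet> (x (n + 1) - xstar))
        + 1 / \<sigma> * ((y n - y (n + 1)) \<bullet> (y (n + 1) - ystar))
        + Lf / 2 * (norm (x (n + 1) - x n))\<^sup>2 + err (n + 1)
        - K (x (n + 1) - extrapolate x n) \<bullet> (y (n + 1) - ystar)" for n
  proof -
    let ?x = "x (n + 1)" and ?y = "y (n + 1)" and ?e = "e (n + 1)" and ?z = "extrapolate x n"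
    have "1 / \<tau> * ((x n - \<tau> *\<^sub>R (adjoint K ?y + gradf (x n) + ?e) - ?x) \<bullet> (?x - xstar))
        = 1 / \<tau> * ((x n - ?x) \<bullet> (?x - xstar)) - K (?x - xstar) \<bullet> ?y
          - gradf (x n) \<bullet> (?x - xstar) - ?e \<bullet> (?x - xstar)"
    proof -
      have "(x n - \<tau> *\<^sub>R (adjoint K ?y + gradf (x n) + ?e) - ?x) \<bullet> w
          = (x n - ?x) \<bullet> w - \<tau> * (K w \<bullet> ?y + gradf (x n) \<bullet> w + ?e \<bullet> w)" for w
        using adjoint_hilbert[OF assms(1), of w ?y]
        by (simp add: inner_simps inner_commute algebra_simps)
      then show ?thesis using pos by (simp add: field_simps)
    qed
    moreover have "- (?e \<bullet> (?x - xstar)) \<le> norm ?e * norm (?x - xstar)"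
      using norm_cauchy_schwarz[of "- ?e" "?x - xstar"] by simp
    moreover have "1 / \<sigma> * ((y n + \<sigma> *\<^sub>R K ?z - ?y) \<bullet> (?y - ystar))
        = 1 / \<sigma> * ((y n - ?y) \<bullet> (?y - ystar)) + K ?z \<bullet> (?y - ystar)"
    proof -
      have "(y n + \<sigma> *\<^sub>R K ?z - ?y) \<bullet> w = (y n - ?y) \<bullet> w + \<sigma> * (K ?z \<bullet> w)" for w
        by (simp add: inner_simps algebra_simps)
      then show ?thesis using pos by (simp add: field_simps)
    qed
    \<comment> \<open>The gradient is taken at the old iterate: the descent inequality leads from
      there to the new iterate, convexity from there to \<open>xstar\<close>.\<close>
    moreover have "F ?x - F xstar \<le> gradf (x n) \<bullet> (?x - xstar) + Lf / 2 * (norm (?x - x n))\<^sup>2"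
      using descent[of ?x "x n"] grad[of "x n" xstar] by (simp add: inner_diff_right)
    moreover have "gap (n + 1) = (G ?x - G xstar) + (F ?x - F xstar) + (H ?y - H ystar)
        + K ?x \<bullet> ystar - K xstar \<bullet> ?y"
      by (simp add: gap_def \<Lambda>_def)
    \<comment> \<open>The first two terms cancel against those from the primal and dual prox
      inequalities; the last is the extrapolation error that telescopes.\<close>
    moreover have "K ?x \<bullet> ystar - K xstar \<bullet> ?y
        = K (?x - xstar) \<bullet> ?y - K ?z \<bullet> (?y - ystar) - K (?x - ?z) \<bullet> (?y - ystar)"
      by (simp add: K.diff inner_simps)
    moreover have "\<alpha> (n + 1) / \<tau> * norm (?x - xstar)
        = norm ?e * norm (?x - xstar) + a (n + 1) / \<tau> * norm (?x - xstar)"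
      using pos by (simp add: \<alpha>_def field_simps)
    ultimately show ?thesis
      using prox_x(2)[OF xsd, of n] prox_y(2)[OF ysd, of n] by (simp only: err_def)
  qed
  have L: "norm (K d) \<le> L * norm d" for d
    using onorm[OF assms(1)] assms(7) by simp
  have "0 \<le> \<tau> * \<beta> * L"
    using onorm_pos_le[OF assms(1)] pos assms(7,8) by simp
  then have cond: "\<tau> * Lf + \<sigma> * \<tau> * L\<^sup>2 \<le> 1" using assms(11) by linarith
  note energy = primal_dual_energy[OF assms(1) L pos cond step]

  have A: "(\<Sum>n=1..N. \<alpha> n) = err_A i \<tau> e \<epsilon> N"
    by (simp add: \<alpha>_def a_def err_A_def)
  have B: "(\<Sum>n=1..N. \<tau> * (b n + \<delta> n)) = err_B i \<tau> \<epsilon> \<delta> N"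
    by (simp add: b_def err_B_def distrib_left)
  have "2 * \<tau> * (\<Sum>n=1..N. gap n)
      \<le> (norm (x 0 - xstar) + sqrt (\<tau> / \<sigma>) * norm (y 0 - ystar)
        + 2 * (\<Sum>n=1..N. \<alpha> n) + sqrt (2 * (\<Sum>n=1..N. \<tau> * (b n + \<delta> n))))\<^sup>2"
  proof (rule quadratic_recursion[where T = "\<lambda>N. 2 * \<tau> * (\<Sum>n=1..N. gap n)"
        and u = "\<lambda>n. norm (x n - xstar)" and B = "\<lambda>N. \<Sum>n=1..N. \<tau> * (b n + \<delta> n)"])
    fix m
    have err: "2 * \<tau> * (\<Sum>n=1..m. err n) = 2 * (\<Sum>n=1..m. \<tau> * (b n + \<delta> n))
        + 2 * (\<Sum>n=1..m. \<alpha> n * norm (x n - xstar))"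
      unfolding err_def sum_distrib_left sum.distrib[symmetric]
      using pos by (intro sum.cong) (auto simp: field_simps)
    \<comment> \<open>Scaling the energy bound by \<open>2 * \<tau>\<close> normalizes the primal
      distance and gives the dual one the weight \<open>\<tau> / \<sigma>\<close>, whose root
      appears in the rate.\<close>
    have "2 * \<tau> * ((\<Sum>n=1..m. gap n) + (norm (x m - xstar))\<^sup>2 / (2 * \<tau>))
        \<le> 2 * \<tau> * ((norm (x 0 - xstar))\<^sup>2 / (2 * \<tau>) + (norm (y 0 - ystar))\<^sup>2 / (2 * \<sigma>) + (\<Sum>n=1..m. err n))"
      using energy[of m] pos by (intro mult_left_mono) auto
    moreover have "2 * \<tau> * ((\<Sum>n=1..m. gap n) + (norm (x m - xstar))\<^sup>2 / (2 * \<tau>))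
        = 2 * \<tau> * (\<Sum>n=1..m. gap n) + (norm (x m - xstar))\<^sup>2"
      using pos by (simp add: field_simps)
    moreover have "2 * \<tau> * ((norm (x 0 - xstar))\<^sup>2 / (2 * \<tau>) + (norm (y 0 - ystar))\<^sup>2 / (2 * \<sigma>) + S)
        = (norm (x 0 - xstar))\<^sup>2 + (sqrt (\<tau> / \<sigma>) * norm (y 0 - ystar))\<^sup>2 + 2 * \<tau> * S" for S
      using pos by (simp add: field_simps power_mult_distrib)
    ultimately show "2 * \<tau> * (\<Sum>n=1..m. gap n) + (norm (x m - xstar))\<^sup>2
        \<le> (norm (x 0 - xstar))\<^sup>2 + (sqrt (\<tau> / \<sigma>) * norm (y 0 - ystar))\<^sup>2
          + 2 * (\<Sum>n=1..m. \<tau> * (b n + \<delta> n)) + 2 * (\<Sum>n=1..m. \<alpha> n * norm (x n - xstar))"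
      by (simp only: err add.assoc)
    show "0 \<le> 2 * \<tau> * (\<Sum>n=1..m. gap n)"
      using pos gap_nonneg by (intro mult_nonneg_nonneg sum_nonneg) auto
  next
    show "mono (\<lambda>N. \<Sum>n=1..N. \<tau> * (b n + \<delta> n))"
      using ab assms(14) pos by (intro monoI sum_mono2) auto
  qed (use ab pos in \<open>auto simp: \<alpha>_def\<close>)
  then have total: "2 * \<tau> * (\<Sum>n=1..N. gap n)
      \<le> (norm (xstar - x 0) + sqrt (\<tau> / \<sigma>) * norm (ystar - y 0)
        + 2 * err_A i \<tau> e \<epsilon> N + sqrt (2 * err_B i \<tau> \<epsilon> \<delta> N))\<^sup>2" (is "_ \<le> ?R")
    unfolding A B by (simp add: norm_minus_commute)

  let ?X = "ergodic_mean x N" and ?Y = "ergodic_mean y N"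
  have meanF: "real N * F ?X \<le> (\<Sum>n=1..N. F (x n))"
    unfolding F_def using f \<open>N \<ge> 1\<close> dom_f by (intro convex_ergodic_mean(2)) auto
  note meanG = convex_ergodic_mean[where x = x, OF g \<open>N \<ge> 1\<close> xd, folded G_def]
  note meanH = convex_ergodic_mean[where x = y, OF hs \<open>N \<ge> 1\<close> yd, folded H_def]
  \<comment> \<open>The gap is convex in each iterate and its bilinear part is affine in each
    argument, so averaging only decreases it.\<close>
  have "real N * (\<Lambda> ?X ystar - \<Lambda> xstar ?Y) \<le> (\<Sum>n=1..N. gap n)"
  proof -
    have "(\<Sum>n=1..N. gap n) = (\<Sum>n=1..N. K (x n) \<bullet> ystar) + (\<Sum>n=1..N. F (x n)) + (\<Sum>n=1..N. G (x n))
        - real N * H ystar - ((\<Sum>n=1..N. K xstar \<bullet> y n) + real N * F xstar + real N * G xstar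
        - (\<Sum>n=1..N. H (y n)))"
      unfolding gap_def \<Lambda>_def by (simp add: sum.distrib sum_subtractf)
    then show ?thesis
      using meanF meanG(2) meanH(2) inner_ergodic_mean(1)[OF K.linear_axioms \<open>N \<ge> 1\<close>, of x ystar]
        inner_ergodic_mean(2)[OF K.linear_axioms \<open>N \<ge> 1\<close>, of "K xstar" y]
      by (simp add: \<Lambda>_def algebra_simps)
  qed
  then have "2 * \<tau> * (real N * (\<Lambda> ?X ystar - \<Lambda> xstar ?Y)) \<le> ?R"
    using total pos mult_left_mono[of _ _ "2 * \<tau>"] by (meson less_imp_le mult_pos_pos order_trans zero_less_numeral)
  then have "\<Lambda> ?X ystar - \<Lambda> xstar ?Y \<le> 1 / (2 * \<tau> * real N) * ?R"
    using pos \<open>N \<ge> 1\<close> by (simp add: field_simps)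
  then show ?thesis
    using Lag[OF meanG(1) ysd] Lag[OF xsd meanH(1)] by simp
qed

end
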